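(* Let $k\ge1$ and let $n$ be a power of $2$. Let $\mathcal D\subset Z_{2^k}^n$ be a linear $(n,\,n2^k,\,n2^{k-2})^*$-code. Then $\mathcal D$ is equivalent to $\mathcal D_I$ for some tuple $I=(i_1,\dots,i_k)$ of nonnegative integers with $i_1+2i_2+\dots+k\,i_k=\log_2n$.
   Context: With $m=2^{k-1}$: $wt^*(0)=0$, $wt^*(m)=m$, $wt^*(x)=m/2$ otherwise, $d^*(\bar x,\bar y)=\sum_iwt^*(y_i-x_i)$; an $(n,M,d)^*$-code is a subset of $Z_{2^k}^n$ of size $M$ with pairwise $d^*$-distance at least $d$. $\mathcal D_I$ is the linear code generated by the rows of the matrix $B_I$ whose columns are all elements of $\{1\}\times(2^{k-1}Z_{2^k})^{i_1}\times(2^{k-2}Z_{2^k})^{i_2}\times\dots\times(2^0Z_{2^k})^{i_k}$ in lexicographic order (equivalently, the dual of $\{\bar h:B_I\bar h^T=\bar0\}$). Linear codes $\mathcal C_1,\mathcal C_2$ are equivalent if $\mathcal C_2=\bar z\circ\pi\mathcal C_1$ for a coordinate permutation $\pi$ and $\bar z\in\{1,3,\dots,2^k-1\}^n$, $\circ$ being the coordinatewise product. *)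

theory Defs
  imports Complex_Main "HOL-Library.Word" "HOL-Combinatorics.Permutations"
    "Jordan_Normal_Form.Matrix"
begin

text \<open>
  The ring of integers modulo \<open>2 ^ k\<close>, \<open>k \<ge> 1\<close>, is the type \<open>'k word\<close> with \<open>k = LENGTH('k)\<close>;
  class \<open>len\<close> guarantees \<open>k > 0\<close>, and numeral types realise every positive \<open>k\<close>.
  Vectors of length \<open>n\<close> are the elements of \<open>carrier_vec n\<close>.
\<close>

text \<open>
  Real-valued, because \<open>m / 2\<close> is not a natural number for \<open>m = 1\<close>. In the test
  \<open>x = 2 ^ (LENGTH('k) - 1)\<close> the power is taken in the ring; in the values it is a real number.
\<close>

definition wt_star :: "'k::len word \<Rightarrow> real" where
  "wt_star x =
    (if x = 0 then 0
     else if x = 2 ^ (LENGTH('k) - 1) then 2 ^ (LENGTH('k) - 1)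
     else 2 ^ (LENGTH('k) - 1) / 2)"

definition d_star :: "'k::len word vec \<Rightarrow> 'k word vec \<Rightarrow> real" where
  "d_star x y = (\<Sum>i<dim_vec y. wt_star (y $ i - x $ i))"

definition star_code :: "nat \<Rightarrow> nat \<Rightarrow> real \<Rightarrow> 'k::len word vec set \<Rightarrow> bool" where
  "star_code n M d C \<longleftrightarrow>
    C \<subseteq> carrier_vec n \<and> finite C \<and> card C = M \<and>
    (\<forall>x\<in>C. \<forall>y\<in>C. x \<noteq> y \<longrightarrow> d \<le> d_star x y)"

definition linear_code :: "nat \<Rightarrow> 'k::len word vec set \<Rightarrow> bool" where
  "linear_code n C \<longleftrightarrow>
    C \<subseteq> carrier_vec n \<and> 0\<^sub>v n \<in> C \<and>
    (\<forall>x\<in>C. \<forall>y\<in>C. x + y \<in> C) \<and>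
    (\<forall>a. \<forall>x\<in>C. a \<cdot>\<^sub>v x \<in> C)"

definition code_equiv :: "nat \<Rightarrow> 'k::len word vec set \<Rightarrow> 'k word vec set \<Rightarrow> bool" where
  "code_equiv n C1 C2 \<longleftrightarrow>
    (\<exists>\<pi> z. \<pi> permutes {..<n} \<and> z \<in> carrier_vec n \<and> (\<forall>i<n. odd (z $ i)) \<and>
      C2 = (\<lambda>x. vec n (\<lambda>i. z $ i * x $ \<pi> i)) ` C1)"

text \<open>
  The tuple \<open>(i\<^sub>1, \<dots>, i\<^sub>k)\<close> is a function \<open>I\<close> of which only the values on \<open>{1..k}\<close> matter.
  The set \<open>2 ^ (k - j) Z\<close> occurs \<open>I j\<close> times as a factor, and is listed
  in the (unsigned) order \<open>0 < 1 < \<dots> < 2 ^ k - 1\<close>. Since \<open>product_lists\<close> varies the last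
  component fastest, it lists the columns in lexicographic order.
\<close>

definition B_columns :: "(nat \<Rightarrow> nat) \<Rightarrow> 'k::len word list list" where
  "B_columns I = product_lists
    ([1] # concat (map (\<lambda>j. replicate (I j)
                              (sorted_list_of_set (range (\<lambda>a. 2 ^ (LENGTH('k) - j) * a))))
                       [1..<Suc LENGTH('k)]))"

definition B_mat :: "(nat \<Rightarrow> nat) \<Rightarrow> 'k::len word mat" where
  "B_mat I = mat_of_cols_list (1 + (\<Sum>j=1..LENGTH('k). I j)) (B_columns I)"

definition D_code :: "(nat \<Rightarrow> nat) \<Rightarrow> 'k::len word vec set" where
  "D_code I = linear_code (dim_col (B_mat I :: 'k word mat)) hull set (rows (B_mat I))"

end

theory Submission
  imports Defs "HOL-Number_Theory.Cong"
begin

text \<open>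
  Let \<open>m = 2 ^ (k - 1)\<close> and let \<open>eps\<close> be \<open>1\<close> at \<open>0\<close>, \<open>- 1\<close> at \<open>m\<close> and \<open>0\<close> elsewhere, so that
  \<open>wt\<^sup>* = (m / 2) (1 - eps)\<close> and the distance bound says that \<open>f c = \<Sum>i<n. eps (c $ i)\<close> is
  nonpositive at all nonzero codewords. As \<open>eps (x + m) = - eps x\<close>, the sums of \<open>f\<close> and \<open>f\<^sup>2\<close> over
  the code are at least \<open>0\<close> and \<open>2 n\<^sup>2\<close>; together with \<open>- n \<le> f\<close> this forces equality everywhere.
  Hence \<open>f \<in> {0, - n}\<close> off zero, every coordinate takes an odd value, and no two coordinates are
  proportional by a unit. Averaging \<open>f\<close> over the subcode \<open>m D\<close> then shows that \<open>(m, \<dots>, m) = m d\<close>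
  for a codeword \<open>d\<close>, whose entries are all odd. Rescaling makes \<open>d\<close> the all-one word, and
  \<open>D = \<langle>1\<rangle> \<oplus> E\<close> where \<open>E\<close> consists of the codewords vanishing at coordinate \<open>0\<close>. For a basis of \<open>E\<close>
  with orders \<open>2 ^ j\<close> the columns of the generator matrix are \<open>n\<close> distinct elements of the set of
  columns of \<open>B_I\<close>, which has exactly \<open>n\<close> elements.
\<close>

section \<open>Arithmetic modulo \<open>2 ^ k\<close>\<close>

lemma word_two_power_length: "(2::'k::len word) ^ LENGTH('k) = 0"
  by simp

lemma word_odd_inverse:
  fixes u :: "'k::len word"
  assumes "odd u" shows "\<exists>w. w * u = 1"
proof -
  have "odd (uint u)" using assms by transfer (auto simp: even_take_bit_eq)
  hence "coprime (uint u) (2 ^ LENGTH('k))" by simp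
  then obtain b where "[uint u * b = 1] (mod 2 ^ LENGTH('k))"
    using cong_solve_coprime_int by blast
  hence "u * word_of_int b = 1"
    by (metis cong_def of_int_1 of_int_mult word_of_int_eq_iff take_bit_eq_mod word_of_int_uint)
  thus ?thesis by (metis mult.commute)
qed

text \<open>Generators of a code are controlled by the powers of two that annihilate them, the
  columns of \<open>B_mat\<close> by sets of multiples; this equivalence translates between the two
  descriptions.\<close>

lemma word_annihilator_two_power:
  fixes x :: "'k::len word"
  assumes "j \<le> LENGTH('k)"
  shows "2 ^ j * x = 0 \<longleftrightarrow> x \<in> range (\<lambda>a. 2 ^ (LENGTH('k) - j) * a)"
proof
  assume "2 ^ j * x = 0"
  hence "word_of_int (2 ^ j * uint x) = (word_of_int 0 :: 'k word)" by simp
  hence "(2::int) ^ LENGTH('k) dvd 2 ^ j * uint x"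
    unfolding word_of_int_eq_iff by (simp add: take_bit_eq_mod mod_eq_0_iff_dvd)
  also have "(2::int) ^ LENGTH('k) = 2 ^ j * 2 ^ (LENGTH('k) - j)"
    using assms by (simp flip: power_add)
  finally have "2 ^ (LENGTH('k) - j) dvd uint x" by simp
  then obtain b where "uint x = 2 ^ (LENGTH('k) - j) * b" by blast
  hence "word_of_int (uint x) = (2 ^ (LENGTH('k) - j) * word_of_int b :: 'k word)" by simp
  thus "x \<in> range (\<lambda>a. 2 ^ (LENGTH('k) - j) * a)" by auto
next
  assume "x \<in> range (\<lambda>a. 2 ^ (LENGTH('k) - j) * a)"
  then obtain a where "x = 2 ^ (LENGTH('k) - j) * a" by blast
  hence "2 ^ j * x = 2 ^ (j + (LENGTH('k) - j)) * a" by (simp add: power_add mult.assoc)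
  thus "2 ^ j * x = 0" using assms by simp
qed

lemma card_word_multiples:
  assumes "j \<le> LENGTH('k::len)"
  shows "card (range (\<lambda>a::'k word. 2 ^ (LENGTH('k) - j) * a)) = 2 ^ j"
proof -
  let ?q = "(2::'k word) ^ (LENGTH('k) - j)"
  have e: "?q * of_nat a = of_nat (2 ^ (LENGTH('k) - j) * a)" for a by simp
  have p: "(2::nat) ^ LENGTH('k) = 2 ^ (LENGTH('k) - j) * 2 ^ j"
    using assms by (simp flip: power_add)
  have inj: "inj_on (\<lambda>a. ?q * of_nat a) {..<2 ^ j}"
  proof (rule inj_onI)
    fix a b :: nat assume a: "a \<in> {..<2 ^ j}" "b \<in> {..<2 ^ j}"
      and "?q * of_nat a = ?q * of_nat b"
    hence "(of_nat (2 ^ (LENGTH('k) - j) * a) :: 'k word) = of_nat (2 ^ (LENGTH('k) - j) * b)"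
      by (simp only: e)
    hence "2 ^ (LENGTH('k) - j) * a = 2 ^ (LENGTH('k) - j) * b"
      unfolding word_of_nat_eq_iff take_bit_eq_mod
      using a by (simp add: p)
    thus "a = b" by simp
  qed
  have "range (\<lambda>a. ?q * a) = (\<lambda>a. ?q * of_nat a) ` {..<2 ^ j}"
  proof (intro equalityI subsetI)
    fix x assume "x \<in> range (\<lambda>a. ?q * a)"
    then obtain a where x: "x = ?q * a" by blast
    \<comment> \<open>Only \<open>a\<close> modulo \<open>2 ^ j\<close> matters: the rest picks up
      the factor \<open>2 ^ (k - j) * 2 ^ j = 0\<close>.\<close>
    have "?q * a = ?q * of_nat (unat a mod 2 ^ j)"
    proof -
      have "a = of_nat (2 ^ j * (unat a div 2 ^ j) + unat a mod 2 ^ j)"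
        by (metis mult_div_mod_eq of_nat_unat ucast_id)
      hence "?q * a = ?q * of_nat (2 ^ j * (unat a div 2 ^ j) + unat a mod 2 ^ j)" by simp
      also have "\<dots> = 2 ^ (LENGTH('k) - j + j) * of_nat (unat a div 2 ^ j)
                     + ?q * of_nat (unat a mod 2 ^ j)"
        by (simp only: of_nat_add of_nat_mult of_nat_power of_nat_numeral power_add)
          (simp only: algebra_simps)
      finally show ?thesis by (simp only: le_add_diff_inverse2[OF assms] word_two_power_length) simp
    qed
    thus "x \<in> (\<lambda>a. ?q * of_nat a) ` {..<2 ^ j}" using x by auto
  qed auto
  thus ?thesis using card_image[OF inj] by simp
qed

section \<open>The element of order two and the function \<open>eps\<close>\<close>

definition half_word :: "'k::len word" where
  "half_word = 2 ^ (LENGTH('k) - 1)"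

lemma two_times_half_word: "2 * (half_word :: 'k::len word) = 0"
  unfolding half_word_def by (metis One_nat_def Suc_pred len_gt_0 power_Suc word_two_power_length)

lemma half_word_nonzero: "(half_word :: 'k::len word) \<noteq> 0"
  by (simp add: half_word_def)

text \<open>As \<open>2 * half_word = 0\<close>, multiplication by \<open>half_word\<close> sees
  only the parity of \<open>a\<close>. This is how odd entries are detected later.\<close>

lemma half_word_mult: "half_word * (a :: 'k::len word) = (if odd a then half_word else 0)"
proof (cases "odd a")
  case True
  then obtain b where "a = 2 * b + 1" by (elim oddE)
  hence "half_word * a = 2 * half_word * b + half_word" by (simp add: algebra_simps)
  thus ?thesis using True two_times_half_word[where 'k='k] by simp
next
  case False
  then obtain b where "a = 2 * b" by blast
  hence "half_word * a = 2 * half_word * b" by (simp add: algebra_simps)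
  thus ?thesis using False two_times_half_word[where 'k='k] by simp
qed

lemma two_times_word_eq_0_iff: "2 * x = 0 \<longleftrightarrow> x = 0 \<or> x = (half_word :: 'k::len word)"
proof
  assume "2 * x = 0"
  then obtain a where "x = half_word * a"
    using word_annihilator_two_power[of 1 x] by (auto simp: half_word_def Suc_le_eq)
  thus "x = 0 \<or> x = half_word" by (cases "odd a") (simp_all only: half_word_mult if_True if_False simp_thms)
qed (use two_times_half_word in auto)

definition eps :: "'k::len word \<Rightarrow> real" where
  "eps x = (if x = 0 then 1 else if x = half_word then - 1 else 0)"

lemma eps_zero [simp]: "eps 0 = 1" and eps_half_word [simp]: "eps half_word = - 1"
  by (simp_all add: eps_def half_word_nonzero)

lemma eps_add_half_word: "eps (x + half_word) = - eps (x :: 'k::len word)"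
proof -
  have "half_word + half_word = (0 :: 'k word)"
    using two_times_half_word[where 'k='k] by simp
  hence "- half_word = (half_word :: 'k word)" by (simp only: minus_unique)
  thus ?thesis by (auto simp: eps_def half_word_nonzero eq_neg_iff_add_eq_0 [symmetric])
qed

lemma wt_star_eps: "wt_star (x :: 'k::len word) = 2 ^ (LENGTH('k) - 1) / 2 * (1 - eps x)"
  by (simp add: wt_star_def eps_def half_word_def)

lemma eps_square: "(eps x)\<^sup>2 = (if 2 * x = 0 then 1 else 0)"
  unfolding two_times_word_eq_0_iff by (simp add: eps_def)

section \<open>Linear codes, their images and hulls\<close>

lemma linear_code_carrier: "linear_code n C \<Longrightarrow> x \<in> C \<Longrightarrow> x \<in> carrier_vec n"
  and linear_code_zero: "linear_code n C \<Longrightarrow> 0\<^sub>v n \<in> C"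
  and linear_code_add: "linear_code n C \<Longrightarrow> x \<in> C \<Longrightarrow> y \<in> C \<Longrightarrow> x + y \<in> C"
  and linear_code_smult: "linear_code n C \<Longrightarrow> x \<in> C \<Longrightarrow> a \<cdot>\<^sub>v x \<in> C"
  by (auto simp: linear_code_def)

lemma linear_code_dim: "linear_code n C \<Longrightarrow> x \<in> C \<Longrightarrow> dim_vec x = n"
  by (auto dest: linear_code_carrier)

lemma linear_code_minus:
  assumes "linear_code n C" "x \<in> C" "y \<in> C"
  shows "x - y \<in> C"
proof -
  have "x - y = x + (- 1) \<cdot>\<^sub>v y"
    using assms by (intro eq_vecI) (auto simp: linear_code_dim)
  thus ?thesis using assms by (simp add: linear_code_add linear_code_smult)
qed

lemma bij_betw_linear_code_add:
  assumes C: "linear_code n C" and t: "t \<in> C"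
  shows "bij_betw (\<lambda>c. c + t) C C"
proof (rule bij_betw_byWitness[where f' = "\<lambda>c. c - t"])
  show "\<forall>c\<in>C. c + t - t = c" "\<forall>c\<in>C. c - t + t = c"
    using t by (auto intro!: eq_vecI simp: linear_code_dim[OF C])
  show "(\<lambda>c. c + t) ` C \<subseteq> C" "(\<lambda>c. c - t) ` C \<subseteq> C"
    using linear_code_add[OF C] linear_code_minus[OF C] t by auto
qed

lemma linear_code_image:
  fixes C :: "'a::len word vec set" and \<psi> :: "'a word vec \<Rightarrow> 'a word vec"
  assumes \<psi>: "\<And>x. x \<in> carrier_vec n \<Longrightarrow> \<psi> x \<in> carrier_vec n"
      "\<And>x y. x \<in> carrier_vec n \<Longrightarrow> y \<in> carrier_vec n \<Longrightarrow> \<psi> (x + y) = \<psi> x + \<psi> y"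
      "\<And>a x. x \<in> carrier_vec n \<Longrightarrow> \<psi> (a \<cdot>\<^sub>v x) = a \<cdot>\<^sub>v \<psi> x"
    and C: "linear_code n C"
  shows "linear_code n (\<psi> ` C)"
  unfolding linear_code_def
proof (intro conjI ballI allI)
  show "\<psi> ` C \<subseteq> carrier_vec n" using linear_code_carrier[OF C] \<psi>(1) by auto
  have zero: "(0::'a word) \<cdot>\<^sub>v 0\<^sub>v n = 0\<^sub>v n" by (intro eq_vecI) auto
  have "dim_vec (\<psi> (0\<^sub>v n)) = n" using \<psi>(1) by (metis carrier_vecD zero_carrier_vec)
  hence "0 \<cdot>\<^sub>v \<psi> (0\<^sub>v n) = 0\<^sub>v n" by (intro eq_vecI) auto
  hence "\<psi> (0\<^sub>v n) = 0\<^sub>v n" using \<psi>(3)[of "0\<^sub>v n" 0] zero by simp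
  thus "0\<^sub>v n \<in> \<psi> ` C" using linear_code_zero[OF C] by (intro image_eqI[where x = "0\<^sub>v n"]) auto
next
  fix x y assume "x \<in> \<psi> ` C" "y \<in> \<psi> ` C"
  then obtain c d where "c \<in> C" "d \<in> C" "x = \<psi> c" "y = \<psi> d" by blast
  thus "x + y \<in> \<psi> ` C"
    using \<psi>(2) linear_code_add[OF C] linear_code_carrier[OF C] by (intro image_eqI[where x = "c + d"]) auto
next
  fix a x assume "x \<in> \<psi> ` C"
  then obtain c where "c \<in> C" "x = \<psi> c" by blast
  thus "a \<cdot>\<^sub>v x \<in> \<psi> ` C"
    using \<psi>(3) linear_code_smult[OF C] linear_code_carrier[OF C] by (intro image_eqI[where x = "a \<cdot>\<^sub>v c"]) auto
qed

lemma linear_code_vimage: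
  fixes C :: "'a::len word vec set" and \<psi> :: "'a word vec \<Rightarrow> 'a word vec"
  assumes \<psi>: "\<And>x. x \<in> carrier_vec n \<Longrightarrow> \<psi> x \<in> carrier_vec n"
      "\<And>x y. x \<in> carrier_vec n \<Longrightarrow> y \<in> carrier_vec n \<Longrightarrow> \<psi> (x + y) = \<psi> x + \<psi> y"
      "\<And>a x. x \<in> carrier_vec n \<Longrightarrow> \<psi> (a \<cdot>\<^sub>v x) = a \<cdot>\<^sub>v \<psi> x"
    and C: "linear_code n C"
  shows "linear_code n {x \<in> carrier_vec n. \<psi> x \<in> C}"
proof -
  have zero: "(0::'a word) \<cdot>\<^sub>v 0\<^sub>v n = 0\<^sub>v n" by (intro eq_vecI) auto
  have "dim_vec (\<psi> (0\<^sub>v n)) = n" using \<psi>(1) by (metis carrier_vecD zero_carrier_vec)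
  hence "0 \<cdot>\<^sub>v \<psi> (0\<^sub>v n) = 0\<^sub>v n" by (intro eq_vecI) auto
  hence "\<psi> (0\<^sub>v n) = 0\<^sub>v n" using \<psi>(3)[of "0\<^sub>v n" 0] zero by simp
  thus ?thesis
    using C \<psi>(2,3) unfolding linear_code_def by simp
qed

text \<open>The hull is an intersection over a nonempty family, because \<open>carrier_vec n\<close>
  is itself a linear code that contains \<open>S\<close>.\<close>

lemma linear_code_hull:
  assumes "S \<subseteq> carrier_vec n" shows "linear_code n (linear_code n hull S)"
proof -
  have "linear_code n (carrier_vec n)" by (simp add: linear_code_def)
  thus ?thesis using assms unfolding hull_def linear_code_def by auto
qed

text \<open>Minimality comes from preimages: if a linear code \<open>C\<close> contains the images
  of \<open>S\<close>, its preimage is a linear code that contains \<open>S\<close> and therefore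
  the hull of \<open>S\<close>.\<close>

lemma hull_linear_code_image:
  fixes S :: "'a::len word vec set" and \<psi> :: "'a word vec \<Rightarrow> 'a word vec"
  assumes \<psi>: "\<And>x. x \<in> carrier_vec n \<Longrightarrow> \<psi> x \<in> carrier_vec n"
      "\<And>x y. x \<in> carrier_vec n \<Longrightarrow> y \<in> carrier_vec n \<Longrightarrow> \<psi> (x + y) = \<psi> x + \<psi> y"
      "\<And>a x. x \<in> carrier_vec n \<Longrightarrow> \<psi> (a \<cdot>\<^sub>v x) = a \<cdot>\<^sub>v \<psi> x"
    and S: "S \<subseteq> carrier_vec n"
  shows "linear_code n hull (\<psi> ` S) = \<psi> ` (linear_code n hull S)"
proof (rule hull_unique)
  show "\<psi> ` S \<subseteq> \<psi> ` (linear_code n hull S)" by (intro image_mono hull_subset)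
  show "linear_code n (\<psi> ` (linear_code n hull S))"
    by (rule linear_code_image[OF \<psi> linear_code_hull[OF S]])
  fix C assume C: "\<psi> ` S \<subseteq> C" "linear_code n C"
  have "linear_code n hull S \<subseteq> {x \<in> carrier_vec n. \<psi> x \<in> C}"
    using S C(1) by (intro hull_minimal linear_code_vimage[OF \<psi> C(2)]) auto
  thus "\<psi> ` (linear_code n hull S) \<subseteq> C" by blast
qed

lemma linear_code_coordinate_kernel:
  "linear_code n C \<Longrightarrow> i < n \<Longrightarrow> linear_code n {c \<in> C. c $ i = 0}"
  by (auto simp: linear_code_def)

lemma finite_linear_code: 
  fixes C :: "'k::len word vec set"
  assumes C: "linear_code n C" shows "finite C"
proof (rule finite_subset)
  show "C \<subseteq> vec_of_list ` {xs. set xs \<subseteq> UNIV \<and> length xs = n}"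
  proof
    fix x assume "x \<in> C"
    hence "dim_vec x = n" by (rule linear_code_dim[OF C])
    thus "x \<in> vec_of_list ` {xs. set xs \<subseteq> UNIV \<and> length xs = n}"
      by (intro image_eqI[where x = "list_of_vec x"]) (auto simp: vec_list)
  qed
qed (intro finite_imageI finite_lists_length_eq, rule finite)

section \<open>Sums of \<open>eps\<close> over a code\<close>

text \<open>Translation by \<open>t\<close> permutes the code and reverses the sign of the
  sum.\<close>

lemma sum_linear_code_eq_0:
  fixes h :: "'k::len word vec \<Rightarrow> real"
  assumes C: "linear_code n C" and t: "t \<in> C"
    and h: "\<And>c. c \<in> C \<Longrightarrow> h (c + t) = - h c"
  shows "(\<Sum>c\<in>C. h c) = 0"
proof -
  have "(\<Sum>c\<in>C. h c) = (\<Sum>c\<in>C. h (c + t))"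
    by (rule sum.reindex_bij_betw[OF bij_betw_linear_code_add[OF C t], symmetric])
  also have "\<dots> = - (\<Sum>c\<in>C. h c)" using h by (simp add: sum_negf)
  finally show ?thesis by simp
qed

text \<open>If \<open>half_word\<close> occurs at \<open>i\<close>, translation by such a codeword
  negates every term. Otherwise no term is negative and the zero word contributes
  \<open>1\<close>.\<close>

lemma sum_eps_linear_code:
  fixes C :: "'k::len word vec set"
  assumes C: "linear_code n C" and i: "i < n"
  shows sum_eps_nonneg: "0 \<le> (\<Sum>c\<in>C. eps (c $ i))"
    and sum_eps_eq_0_iff: "(\<Sum>c\<in>C. eps (c $ i)) = 0 \<longleftrightarrow> (\<exists>c\<in>C. c $ i = half_word)"
proof -
  have 1: "(\<Sum>c\<in>C. eps (c $ i)) = 0" if t: "t \<in> C" "t $ i = half_word" for t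
    using t i
    by (intro sum_linear_code_eq_0[OF C t(1)]) (simp add: linear_code_dim[OF C] eps_add_half_word)
  have 2: "0 < (\<Sum>c\<in>C. eps (c $ i))" if "\<not> (\<exists>c\<in>C. c $ i = half_word)"
  proof (rule sum_pos2[of _ "0\<^sub>v n"])
    show "0 \<le> eps (c $ i)" if "c \<in> C" for c
      using \<open>\<not> _\<close> that by (auto simp: eps_def)
  qed (use finite_linear_code[OF C] linear_code_zero[OF C] i in auto)
  show "0 \<le> (\<Sum>c\<in>C. eps (c $ i))"
    using 1 2 by (cases "\<exists>c\<in>C. c $ i = half_word") fastforce+
  show "(\<Sum>c\<in>C. eps (c $ i)) = 0 \<longleftrightarrow> (\<exists>c\<in>C. c $ i = half_word)"
    using 1 2 by (cases "\<exists>c\<in>C. c $ i = half_word") fastforce+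
qed

lemma sum_eps_mult_linear_code:
  fixes C :: "'k::len word vec set"
  assumes C: "linear_code n C" and i: "i < n" and j: "j < n"
  shows sum_eps_mult_nonneg: "0 \<le> (\<Sum>c\<in>C. eps (c $ i) * eps (c $ j))"
    and sum_eps_mult_eq_0:
      "(\<Sum>c\<in>C. eps (c $ i) * eps (c $ j)) = 0 \<Longrightarrow> \<exists>c\<in>C. c $ i = 0 \<longleftrightarrow> c $ j \<noteq> 0"
proof -
  \<comment> \<open>\<open>Q c\<close> says that the product of the two \<open>eps\<close> values is
    \<open>-1\<close>; translation by such a word negates exactly one factor. Without such a word
    all products are nonnegative.\<close>
  define Q where "Q c \<longleftrightarrow> c $ i = 0 \<and> c $ j = half_word \<or> c $ i = half_word \<and> c $ j = 0"
    for c :: "'k word vec"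
  have 1: "(\<Sum>c\<in>C. eps (c $ i) * eps (c $ j)) = 0" if t: "t \<in> C" "Q t" for t
    using t i j unfolding Q_def
    by (intro sum_linear_code_eq_0[OF C t(1)])
      (auto simp: linear_code_dim[OF C] eps_add_half_word)
  have 2: "0 < (\<Sum>c\<in>C. eps (c $ i) * eps (c $ j))" if "\<not> (\<exists>c\<in>C. Q c)"
  proof (rule sum_pos2[of _ "0\<^sub>v n"])
    show "0 \<le> eps (c $ i) * eps (c $ j)" if "c \<in> C" for c
      using \<open>\<not> _\<close> that by (auto simp: eps_def Q_def)
  qed (use finite_linear_code[OF C] linear_code_zero[OF C] i j in auto)
  show "0 \<le> (\<Sum>c\<in>C. eps (c $ i) * eps (c $ j))"
    using 1 2 by (cases "\<exists>c\<in>C. Q c") fastforce+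
  assume "(\<Sum>c\<in>C. eps (c $ i) * eps (c $ j)) = 0"
  then obtain c where "c \<in> C" "Q c" using 2 by force
  thus "\<exists>c\<in>C. c $ i = 0 \<longleftrightarrow> c $ j \<noteq> 0"
    using half_word_nonzero[where 'k='k] unfolding Q_def by metis
qed

section \<open>Counting codewords through one coordinate\<close>

text \<open>The map taking \<open>c\<close> to \<open>a * c $ i\<close> is additive, so its nonempty
  fibres are translates of its kernel.\<close>

lemma card_linear_code_coordinate:
  fixes C :: "'k::len word vec set"
  assumes C: "linear_code n C" and i: "i < n"
  shows "card C = card ((\<lambda>c. a * c $ i) ` C) * card {c \<in> C. a * c $ i = 0}"
proof -
  let ?\<phi> = "\<lambda>c. a * c $ i"
  have fin: "finite C" by (rule finite_linear_code[OF C])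
  have fib: "card {c \<in> C. ?\<phi> c = y} = card {c \<in> C. ?\<phi> c = 0}" if "y \<in> ?\<phi> ` C" for y
  proof -
    from that obtain t where t: "t \<in> C" "y = a * t $ i" by blast
    have "bij_betw (\<lambda>c. c + t) {c \<in> C. ?\<phi> c = 0} {c \<in> C. ?\<phi> c = y}"
    proof (rule bij_betw_byWitness[where f' = "\<lambda>c. c - t"])
      show "\<forall>c\<in>{c \<in> C. ?\<phi> c = 0}. c + t - t = c" "\<forall>c\<in>{c \<in> C. ?\<phi> c = y}. c - t + t = c"
        using t by (auto intro!: eq_vecI simp: linear_code_dim[OF C])
      show "(\<lambda>c. c + t) ` {c \<in> C. ?\<phi> c = 0} \<subseteq> {c \<in> C. ?\<phi> c = y}"
        "(\<lambda>c. c - t) ` {c \<in> C. ?\<phi> c = y} \<subseteq> {c \<in> C. ?\<phi> c = 0}"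
        using linear_code_add[OF C] linear_code_minus[OF C] t i
        by (auto simp: linear_code_dim[OF C] algebra_simps)
    qed
    thus ?thesis by (simp add: bij_betw_same_card)
  qed
  have "card C = (\<Sum>y\<in>?\<phi> ` C. card {c \<in> C. ?\<phi> c = y})"
    using fin sum.image_gen[of C "\<lambda>_. 1::nat" ?\<phi>] by simp
  also have "\<dots> = card (?\<phi> ` C) * card {c \<in> C. ?\<phi> c = 0}" using fib by simp
  finally show ?thesis .
qed

text \<open>The doubled coordinate takes values among the \<open>2 ^ (k - 1)\<close> even multiples,
  so its kernel has at least \<open>n * 2 ^ k / 2 ^ (k - 1)\<close> elements, with equality only if
  all those values occur.\<close>

lemma card_double_coordinate:
  fixes D :: "'k::len word vec set"
  assumes D: "linear_code n D" and cD: "card D = n * 2 ^ LENGTH('k)" and i: "i < n"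
  shows double_coordinate_kernel: "2 * n \<le> card {c \<in> D. 2 * c $ i = 0}"
    and double_coordinate_surj: "card {c \<in> D. 2 * c $ i = 0} = 2 * n \<Longrightarrow>
      (\<lambda>c. 2 * c $ i) ` D = range (\<lambda>a. 2 * a)"
proof -
  let ?im = "(\<lambda>c. 2 * c $ i) ` D" and ?K = "card {c \<in> D. 2 * c $ i = 0}"
  define p where "p = (2::nat) ^ (LENGTH('k) - 1)"
  have p: "2 ^ LENGTH('k) = 2 * p" "p > 0"
    by (simp_all add: p_def flip: power_Suc)
  have r: "card (range (\<lambda>a::'k word. 2 * a)) = p"
    using card_word_multiples[where 'k='k, of "LENGTH('k) - 1"] by (simp add: p_def Suc_le_eq)
  have sub: "?im \<subseteq> range (\<lambda>a::'k word. 2 * a)" by auto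
  hence le: "card ?im \<le> p" using card_mono[OF _ sub] r by simp
  have eq: "p * (2 * n) = card ?im * ?K"
    using card_linear_code_coordinate[OF D i, of 2] cD p by (simp add: mult_ac)
  also have "\<dots> \<le> p * ?K" using le by simp
  finally show "2 * n \<le> ?K" using p by simp
  assume "?K = 2 * n"
  hence "card ?im = p" using eq i by simp
  thus "?im = range (\<lambda>a. 2 * a)" using r sub by (intro card_subset_eq) auto
qed

text \<open>For \<open>k = 1\<close> the element \<open>half_word\<close> is \<open>1\<close>, hence
  odd. For larger \<open>k\<close> it is even, and an entry whose double is \<open>2\<close> equals
  \<open>1\<close> or \<open>half_word + 1\<close>.\<close>

lemma exists_odd_coordinate:
  fixes D :: "'k::len word vec set"
  assumes "\<exists>c\<in>D. c $ i = half_word" and "(\<lambda>c. 2 * c $ i) ` D = range (\<lambda>a. 2 * a)"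
  shows "\<exists>c\<in>D. odd (c $ i)"
proof (cases "LENGTH('k) = 1")
  case True
  hence "half_word = (1 :: 'k word)" by (simp add: half_word_def)
  thus ?thesis using assms(1) odd_one by metis
next
  case False
  then obtain q where "LENGTH('k) - 1 = Suc q"
    using len_gt_0[where 'a='k] by (metis diff_is_0_eq le_antisym Suc_leI One_nat_def not0_implies_Suc)
  hence ev: "even (half_word :: 'k word)" unfolding half_word_def by simp
  have "2 * 1 \<in> (\<lambda>c. 2 * c $ i) ` D" using assms(2) by blast
  then obtain c where c: "c \<in> D" "2 * c $ i = 2" by auto
  hence "2 * (c $ i - 1) = 0" by (simp add: right_diff_distrib)
  hence "c $ i - 1 = 0 \<or> c $ i - 1 = half_word" by (simp only: two_times_word_eq_0_iff)
  hence "c $ i = 1 \<or> c $ i = half_word + 1" by (auto simp: algebra_simps)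
  hence "odd (c $ i)" using ev by auto
  thus ?thesis using c(1) by blast
qed

section \<open>Consequences of the distance bound\<close>

text \<open>With \<open>m = 2 ^ (k - 1)\<close> and \<open>f c\<close> the sum of \<open>eps\<close>
  over the entries, the distance of \<open>c\<close> from the zero word is
  \<open>(m / 2) * (n - f c)\<close>, while the bound is \<open>n * m / 2\<close>. The integer
  exponent of \<open>powi\<close> covers \<open>k = 1\<close>, where it is
  \<open>-1\<close>.\<close>

lemma sum_eps_nonpos:
  fixes D :: "'k::len word vec set"
  assumes D: "linear_code n D"
    and star: "star_code n M (real n * 2 powi (int LENGTH('k) - 2)) D"
    and c: "c \<in> D" "c \<noteq> 0\<^sub>v n"
  shows "(\<Sum>i<n. eps (c $ i)) \<le> 0"
proof -
  define p where "p = (2::real) ^ (LENGTH('k) - 1)"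
  have "2 ^ LENGTH('k) = 2 * p"
    unfolding p_def using power_minus_mult[of "LENGTH('k)" "2::real"] by simp
  hence p: "(2::real) powi (int LENGTH('k) - 2) = p / 2"
    by (simp add: p_def power_int_diff power_diff power2_eq_square)
  have "real n * (p / 2) \<le> d_star (0\<^sub>v n) c"
    using star linear_code_zero[OF D] c unfolding star_code_def p by metis
  also have "d_star (0\<^sub>v n) c = (\<Sum>i<n. p / 2 * (1 - eps (c $ i)))"
    unfolding d_star_def linear_code_dim[OF D c(1)] by (simp add: wt_star_eps p_def)
  also have "\<dots> = p / 2 * (real n - (\<Sum>i<n. eps (c $ i)))"
    by (simp only: sum_subtractf sum_distrib_left [symmetric]) simp
  finally have "p / 2 * (\<Sum>i<n. eps (c $ i)) \<le> 0" by (simp add: algebra_simps)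
  moreover have "p > 0" by (simp add: p_def)
  ultimately show ?thesis by (simp add: mult_le_0_iff)
qed

text \<open>
  Writing \<open>f c = (\<Sum>i<n. eps (c $ i))\<close>, the sum of \<open>f c * (f c + n)\<close> over the nonzero codewords
  has only nonpositive terms, while the first two moments of \<open>f\<close> make it nonnegative.
\<close>

lemma star_code_extremal:
  fixes D :: "'k::len word vec set"
  assumes D: "linear_code n D"
    and star: "star_code n (n * 2 ^ LENGTH('k)) (real n * 2 powi (int LENGTH('k) - 2)) D"
  shows star_code_odd_coordinate: "i < n \<Longrightarrow> \<exists>c\<in>D. odd (c $ i)"
    and star_code_separates: "i < n \<Longrightarrow> j < n \<Longrightarrow> i \<noteq> j \<Longrightarrow> \<exists>c\<in>D. c $ i = 0 \<longleftrightarrow> c $ j \<noteq> 0"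
    and star_code_two_values: "c \<in> D \<Longrightarrow> c \<noteq> 0\<^sub>v n \<Longrightarrow>
      (\<Sum>i<n. eps (c $ i)) = 0 \<or> (\<Sum>i<n. eps (c $ i)) = - real n"
proof -
  define f where "f c = (\<Sum>i<n. eps (c $ i))" for c :: "'k word vec"
  define T where "T i j = (\<Sum>c\<in>D. eps (c $ i) * eps (c $ j))" for i j
  define A where "A i = (\<Sum>c\<in>D. eps (c $ i))" for i
  have fin: "finite D" by (rule finite_linear_code[OF D])
  have cD: "card D = n * 2 ^ LENGTH('k)" using star by (simp add: star_code_def)
  \<comment> \<open>The square of \<open>eps\<close> is the indicator of \<open>2 * x = 0\<close>,
    so the diagonal terms count the kernel of a doubled coordinate.\<close>
  have Tii: "T i i = card {c \<in> D. 2 * c $ i = 0}" for i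
    using fin by (simp add: T_def flip: power2_eq_square)
      (simp add: eps_square flip: sum.inter_filter)
  have T0: "0 \<le> T i i - 2 * real n" if "i < n" for i
    using double_coordinate_kernel[OF D cD that] unfolding Tii by linarith
  have T1: "0 \<le> T i j" if "i < n" "j < n" for i j
    unfolding T_def using sum_eps_mult_nonneg[OF D that] .
  have A0: "0 \<le> A i" if "i < n" for i
    unfolding A_def using sum_eps_nonneg[OF D that] .
  have f_nonpos: "f c \<le> 0" if "c \<in> D - {0\<^sub>v n}" for c
    using sum_eps_nonpos[OF D star] that unfolding f_def by blast
  have "- 1 \<le> eps x" for x :: "'k word" by (simp add: eps_def)
  hence f_ge: "- real n \<le> f c" for c
    using sum_mono[of "{..<n}" "\<lambda>_. - 1" "\<lambda>i. eps (c $ i)"] by (simp add: f_def)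
  have f0: "f (0\<^sub>v n) = n" by (simp add: f_def)
  have le: "0 \<le> - (f c * (f c + n))" if "c \<in> D - {0\<^sub>v n}" for c
    using f_nonpos[OF that] f_ge[of c] by (simp add: mult_le_0_iff)
  have S1: "(\<Sum>c\<in>D. f c) = (\<Sum>i<n. A i)"
    unfolding f_def A_def by (rule sum.swap)
  have "(\<Sum>c\<in>D. f c * f c) = (\<Sum>c\<in>D. \<Sum>i<n. \<Sum>j<n. eps (c $ i) * eps (c $ j))"
    by (simp add: f_def sum_product)
  also have "\<dots> = (\<Sum>i<n. \<Sum>c\<in>D. \<Sum>j<n. eps (c $ i) * eps (c $ j))"
    by (rule sum.swap)
  also have "\<dots> = (\<Sum>i<n. \<Sum>j<n. T i j)"
    unfolding T_def by (intro sum.cong refl sum.swap)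
  finally have S2: "(\<Sum>c\<in>D. f c * f c) = (\<Sum>i<n. \<Sum>j<n. T i j)" .
  \<comment> \<open>The zero word contributes \<open>n * (n + n)\<close> to the sum of
    \<open>f c * (f c + n)\<close>. Subtracting this in portions of \<open>2 * n\<close>, one per
    coordinate, pairs it with the diagonal terms \<open>T i i\<close>, each at least
    \<open>2 * n\<close>.\<close>
  have "(\<Sum>i<n. n * A i + (T i i - 2 * real n) + (\<Sum>j\<in>{..<n} - {i}. T i j))
      = (\<Sum>i<n. n * A i - 2 * real n + (\<Sum>j<n. T i j))"
    by (intro sum.cong refl) (subst sum.remove[of "{..<n}"], auto)
  also have "\<dots> = (\<Sum>c\<in>D. f c * (f c + n)) - 2 * real n * real n"
    using S1 S2 by (simp add: sum.distrib sum_subtractf distrib_left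
        flip: sum_distrib_left sum_distrib_right)
  also have "\<dots> = (\<Sum>c\<in>D - {0\<^sub>v n}. f c * (f c + n))"
    using sum.remove[OF fin linear_code_zero[OF D], of "\<lambda>c. f c * (f c + n)"] f0
    by (simp add: algebra_simps)
  finally have eq: "(\<Sum>i<n. n * A i + (T i i - 2 * real n) + (\<Sum>j\<in>{..<n} - {i}. T i j))
      + (\<Sum>c\<in>D - {0\<^sub>v n}. - (f c * (f c + n))) = 0"
    by (simp add: sum_negf)
  have term0: "0 \<le> n * A i + (T i i - 2 * real n) + (\<Sum>j\<in>{..<n} - {i}. T i j)" if "i < n" for i
    using A0[OF that] T0[OF that] T1[OF that]
    by (intro add_nonneg_nonneg sum_nonneg mult_nonneg_nonneg) auto
  \<comment> \<open>Both summands in \<open>eq\<close> are nonnegative, so both vanish; taken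
    termwise, this gives all the equality cases below.\<close>
  have z: "(\<Sum>i<n. n * A i + (T i i - 2 * real n) + (\<Sum>j\<in>{..<n} - {i}. T i j)) = 0"
    "(\<Sum>c\<in>D - {0\<^sub>v n}. - (f c * (f c + n))) = 0"
  proof -
    have "0 \<le> (\<Sum>i<n. n * A i + (T i i - 2 * real n) + (\<Sum>j\<in>{..<n} - {i}. T i j))"
      by (rule sum_nonneg) (use term0 in auto)
    moreover have "0 \<le> (\<Sum>c\<in>D - {0\<^sub>v n}. - (f c * (f c + n)))"
      by (rule sum_nonneg) (use le in auto)
    ultimately show "(\<Sum>i<n. n * A i + (T i i - 2 * real n) + (\<Sum>j\<in>{..<n} - {i}. T i j)) = 0"
      "(\<Sum>c\<in>D - {0\<^sub>v n}. - (f c * (f c + n))) = 0"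
      using eq by linarith+
  qed
  show "(\<Sum>i<n. eps (c $ i)) = 0 \<or> (\<Sum>i<n. eps (c $ i)) = - real n" if "c \<in> D" "c \<noteq> 0\<^sub>v n"
  proof -
    have "- (f c * (f c + n)) = 0"
      using z(2) sum_nonneg_eq_0_iff[of "D - {0\<^sub>v n}" "\<lambda>c. - (f c * (f c + n))"] le fin that
      by simp
    thus ?thesis unfolding f_def by auto
  qed
  have z1: "n * A i + (T i i - 2 * real n) + (\<Sum>j\<in>{..<n} - {i}. T i j) = 0" if "i < n" for i
    using z(1) sum_nonneg_eq_0_iff[of "{..<n}" "\<lambda>i. n * A i + (T i i - 2 * real n) + (\<Sum>j\<in>{..<n} - {i}. T i j)"]
      term0 that by simp
  have z2: "A i = 0" "T i i = 2 * real n" "(\<Sum>j\<in>{..<n} - {i}. T i j) = 0" if "i < n" for i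
  proof -
    have "0 \<le> n * A i" "0 \<le> (\<Sum>j\<in>{..<n} - {i}. T i j)"
      using A0[OF that] T1[OF that] by (auto intro!: sum_nonneg)
    thus "T i i = 2 * real n" "(\<Sum>j\<in>{..<n} - {i}. T i j) = 0"
      using z1[OF that] T0[OF that] by linarith+
    have "n * A i = 0"
      using z1[OF that] T0[OF that] \<open>0 \<le> n * A i\<close> \<open>0 \<le> (\<Sum>j\<in>{..<n} - {i}. T i j)\<close> by linarith
    thus "A i = 0" using that by simp
  qed
  \<comment> \<open>\<open>A i = 0\<close> provides an entry \<open>half_word\<close>, and
    \<open>T i i = 2 * n\<close> makes the doubled coordinate attain every even value.\<close>
  show "\<exists>c\<in>D. odd (c $ i)" if i: "i < n"
  proof (rule exists_odd_coordinate)
    show "\<exists>c\<in>D. c $ i = half_word"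
      using z2(1)[OF i] sum_eps_eq_0_iff[OF D i] by (simp add: A_def)
    have "card {c \<in> D. 2 * c $ i = 0} = 2 * n" using z2(2)[OF i] unfolding Tii by linarith
    thus "(\<lambda>c. 2 * c $ i) ` D = range (\<lambda>a. 2 * a)" by (rule double_coordinate_surj[OF D cD i])
  qed
  show "\<exists>c\<in>D. c $ i = 0 \<longleftrightarrow> c $ j \<noteq> 0" if ij: "i < n" "j < n" "i \<noteq> j"
  proof (rule sum_eps_mult_eq_0[OF D ij(1,2)])
    have "T i j = 0"
      using z2(3)[OF ij(1)] sum_nonneg_eq_0_iff[of "{..<n} - {i}" "T i"] T1[OF ij(1)] ij by simp
    thus "(\<Sum>c\<in>D. eps (c $ i) * eps (c $ j)) = 0" by (simp add: T_def)
  qed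
qed

text \<open>In the subcode of multiples by \<open>half_word\<close>, each coordinate attains
  \<open>half_word\<close>, so \<open>f\<close> sums to zero there. The zero word contributes
  \<open>n > 0\<close>, hence some word has negative \<open>f\<close> and thus
  \<open>f = - n\<close>. All its entries are \<open>half_word\<close>, so it is
  \<open>half_word\<close> times a codeword with only odd entries.\<close>

lemma star_code_all_odd:
  fixes D :: "'k::len word vec set"
  assumes D: "linear_code n D" and n: "n > 0"
    and star: "star_code n (n * 2 ^ LENGTH('k)) (real n * 2 powi (int LENGTH('k) - 2)) D"
  shows "\<exists>d\<in>D. \<forall>i<n. odd (d $ i)"
proof -
  let ?h = "half_word :: 'k word"
  let ?H = "(\<lambda>c. ?h \<cdot>\<^sub>v c) ` D"
  define f where "f c = (\<Sum>i<n. eps (c $ i))" for c :: "'k word vec"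
  have H: "linear_code n ?H" 
    by (rule linear_code_image[OF _ _ _ D]) (auto simp: smult_add_distrib_vec smult_smult_assoc mult.commute)
  have "(\<Sum>c\<in>?H. eps (c $ i)) = 0" if i: "i < n" for i
  proof -
    obtain c where "c \<in> D" "odd (c $ i)" using star_code_odd_coordinate[OF D star i] by blast
    hence "(?h \<cdot>\<^sub>v c) $ i = ?h" using i by (simp add: linear_code_dim[OF D] half_word_mult)
    thus ?thesis using sum_eps_eq_0_iff[OF H i] \<open>c \<in> D\<close> by blast
  qed
  hence "(\<Sum>c\<in>?H. f c) = 0" unfolding f_def by (subst sum.swap) simp
  moreover have "(\<Sum>c\<in>?H. f c) = f (0\<^sub>v n) + (\<Sum>c\<in>?H - {0\<^sub>v n}. f c)"
    using sum.remove[OF finite_linear_code[OF H] linear_code_zero[OF H]] by blast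
  moreover have "f (0\<^sub>v n) > 0" using n by (simp add: f_def)
  ultimately have "(\<Sum>c\<in>?H - {0\<^sub>v n}. f c) < 0" by linarith
  hence "\<not> (\<forall>v\<in>?H - {0\<^sub>v n}. 0 \<le> f v)"
    using sum_nonneg[of "?H - {0\<^sub>v n}" f] by auto
  then obtain v where v: "v \<in> ?H" "v \<noteq> 0\<^sub>v n" "f v < 0" by force
  then obtain d where d: "d \<in> D" "v = ?h \<cdot>\<^sub>v d" by blast
  hence "f v = - real n"
    using star_code_two_values[OF D star linear_code_smult[OF D d(1)], of ?h] v unfolding f_def by auto
  hence "(\<Sum>i<n. eps (v $ i) + 1) = 0" by (simp add: f_def sum.distrib)
  moreover have "0 \<le> eps x + 1" for x :: "'k word" by (simp add: eps_def)
  ultimately have "\<forall>i\<in>{..<n}. eps (v $ i) + 1 = 0"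
    using sum_nonneg_eq_0_iff[of "{..<n}" "\<lambda>i. eps (v $ i) + 1"] by simp
  hence "eps (v $ i) = - 1" if "i < n" for i
    using that by (simp add: eq_neg_iff_add_eq_0)
  hence "eps (half_word * d $ i) = - 1" if "i < n" for i
    using that d by (simp add: linear_code_dim[OF D])
  hence "odd (d $ i)" if "i < n" for i
    using that by (fastforce simp: half_word_mult)
  thus ?thesis using d(1) by blast
qed

section \<open>Bases of linear codes\<close>

text \<open>
  Gaussian elimination: if \<open>L\<close> is least with \<open>2 ^ L\<close> annihilating the code, some codeword has an
  entry \<open>2 ^ (k - L)\<close>, which divides all entries of all codewords and so serves as a pivot.
\<close>

lemma linear_code_basis:
  fixes E :: "'k::len word vec set"
  assumes "linear_code n E" and "J \<le> LENGTH('k)" and "\<And>c. c \<in> E \<Longrightarrow> 2 ^ J \<cdot>\<^sub>v c = 0\<^sub>v n"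
  shows "\<exists>es. sorted (map snd es) \<and>
    (\<forall>(e, j)\<in>set es. 1 \<le> j \<and> j \<le> J \<and> 2 ^ j \<cdot>\<^sub>v e = 0\<^sub>v n) \<and>
    linear_code n hull (fst ` set es) = E \<and> card E = 2 ^ sum_list (map snd es)"
  using assms
proof (induction "card E" arbitrary: E J rule: less_induct)
  case less
  note E = \<open>linear_code n E\<close>
  show ?case
  proof (cases "E = {0\<^sub>v n}")
    case True
    have "linear_code n hull {} = E"
      using E True by (intro hull_unique) (auto dest: linear_code_zero)
    thus ?thesis using True by (intro exI[where x = "[]"]) auto
  next
    case False
    define ann where "ann j \<longleftrightarrow> (\<forall>c\<in>E. 2 ^ j \<cdot>\<^sub>v c = 0\<^sub>v n)" for j :: nat
    define L where "L = (LEAST j. ann j)"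
    have "ann J" using less.prems(3) by (simp add: ann_def)
    hence L: "ann L" and LJ: "L \<le> J" unfolding L_def by (auto intro: LeastI Least_le)
    have Lk: "L \<le> LENGTH('k)" using LJ less.prems(2) by simp
    have L0: "L \<noteq> 0"
    proof
      assume "L = 0"
      hence "E \<subseteq> {0\<^sub>v n}" using L by (auto simp: ann_def)
      thus False using False linear_code_zero[OF E] by auto
    qed
    hence "\<not> ann (L - 1)" unfolding L_def using not_less_Least[of "L - 1" ann] L_def by simp
    then obtain c where c: "c \<in> E" "2 ^ (L - 1) \<cdot>\<^sub>v c \<noteq> 0\<^sub>v n" by (auto simp: ann_def)
    have "\<exists>i<n. 2 ^ (L - 1) * c $ i \<noteq> 0"
    proof (rule ccontr)
      assume "\<not> (\<exists>i<n. 2 ^ (L - 1) * c $ i \<noteq> 0)"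
      hence "2 ^ (L - 1) \<cdot>\<^sub>v c = 0\<^sub>v n"
        by (intro eq_vecI) (auto simp: linear_code_dim[OF E c(1)])
      thus False using c(2) by contradiction
    qed
    then obtain i where i: "i < n" "2 ^ (L - 1) * c $ i \<noteq> 0" by blast
    have pivot: "\<exists>a. x $ i = 2 ^ (LENGTH('k) - L) * a" if "x \<in> E" for x
    proof -
      have "(2 ^ L \<cdot>\<^sub>v x) $ i = 0" using L that i(1) by (simp add: ann_def)
      hence "2 ^ L * x $ i = 0" using that i(1) by (simp add: linear_code_dim[OF E])
      thus ?thesis using word_annihilator_two_power[OF Lk] by blast
    qed
    then obtain u where u: "c $ i = 2 ^ (LENGTH('k) - L) * u" using c(1) by blast
    \<comment> \<open>An even \<open>u\<close> would supply the factor \<open>2\<close> missing from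
      \<open>2 ^ (L - 1) * 2 ^ (k - L)\<close>, and the product chosen to be nonzero at
      \<open>i\<close> would vanish.\<close>
    have "odd u"
    proof
      assume "even u"
      then obtain b where "u = 2 * b" by blast
      hence "2 ^ (L - 1) * c $ i = 2 ^ (L - 1 + (LENGTH('k) - L) + 1) * b"
        by (simp add: u power_add mult_ac)
      also have "L - 1 + (LENGTH('k) - L) + 1 = LENGTH('k)" using L0 Lk by simp
      finally show False using i(2) by simp
    qed
    then obtain w where w: "w * u = 1" using word_odd_inverse by blast
    define e where "e = w \<cdot>\<^sub>v c"
    have e: "e \<in> E" using linear_code_smult[OF E c(1)] by (simp add: e_def)
    have "e $ i = 2 ^ (LENGTH('k) - L) * (w * u)"
      using i(1) by (simp add: e_def linear_code_dim[OF E c(1)] u mult_ac)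
    hence ei: "e $ i = 2 ^ (LENGTH('k) - L)" by (simp only: w mult_1_right)
    define E' where "E' = {x \<in> E. x $ i = 0}"
    have E': "linear_code n E'" unfolding E'_def by (rule linear_code_coordinate_kernel[OF E i(1)])
    \<comment> \<open>The pivot makes coordinate \<open>i\<close> attain all \<open>2 ^ L\<close>
      multiples of \<open>2 ^ (k - L)\<close>. The factor \<open>1\<close> fits the form of
      \<open>card_linear_code_coordinate\<close>.\<close>
    have "(\<lambda>x. 1 * x $ i) ` E = range (\<lambda>a. 2 ^ (LENGTH('k) - L) * a)"
    proof (intro equalityI subsetI)
      fix y assume "y \<in> range (\<lambda>a::'k word. 2 ^ (LENGTH('k) - L) * a)"
      then obtain a where "y = 2 ^ (LENGTH('k) - L) * a" by blast
      hence "y = 1 * (a \<cdot>\<^sub>v e) $ i" using i(1) ei by (simp add: linear_code_dim[OF E e])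
      thus "y \<in> (\<lambda>x. 1 * x $ i) ` E" using linear_code_smult[OF E e] by blast
    qed (use pivot in auto)
    hence card: "card E = 2 ^ L * card E'"
      using card_linear_code_coordinate[OF E i(1), of 1] card_word_multiples[OF Lk]
      by (simp add: E'_def)
    have "card E' > 0"
      using linear_code_zero[OF E'] finite_linear_code[OF E'] card_gt_0_iff by blast
    moreover have "1 < (2::nat) ^ L" using L0 by (intro one_less_power) auto
    ultimately have "card E' < card E" using card by simp
    moreover have "2 ^ L \<cdot>\<^sub>v x = 0\<^sub>v n" if "x \<in> E'" for x
      using L that by (simp add: ann_def E'_def)
    ultimately obtain es where es: "sorted (map snd es)"
      "\<forall>(e, j)\<in>set es. 1 \<le> j \<and> j \<le> L \<and> 2 ^ j \<cdot>\<^sub>v e = 0\<^sub>v n"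
      "linear_code n hull (fst ` set es) = E'" "card E' = 2 ^ sum_list (map snd es)"
      using less.hyps[OF _ E' Lk] by blast
    have "linear_code n hull (insert e (fst ` set es)) = E"
    proof (rule hull_unique)
      show "insert e (fst ` set es) \<subseteq> E"
        using e es(3) hull_subset[of "fst ` set es" "linear_code n"] by (auto simp: E'_def)
    next
      fix C assume C: "insert e (fst ` set es) \<subseteq> C" "linear_code n C"
      hence "E' \<subseteq> C" using es(3) hull_minimal by (metis insert_subset)
      show "E \<subseteq> C"
      proof
        fix x assume x: "x \<in> E"
        then obtain a where a: "x $ i = 2 ^ (LENGTH('k) - L) * a" using pivot by blast
        \<comment> \<open>Elimination step: subtracting a multiple of the pivot word clears entry
          \<open>i\<close>.\<close>
        have "x - a \<cdot>\<^sub>v e \<in> E'"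
          using linear_code_minus[OF E x linear_code_smult[OF E e]] i(1) a ei
          by (simp add: E'_def linear_code_dim[OF E] x e)
        moreover have "x = (x - a \<cdot>\<^sub>v e) + a \<cdot>\<^sub>v e"
          by (intro eq_vecI) (auto simp: linear_code_dim[OF E] x e)
        moreover have "a \<cdot>\<^sub>v e \<in> C" using C by (intro linear_code_smult[OF C(2)]) auto
        ultimately show "x \<in> C" using \<open>E' \<subseteq> C\<close> linear_code_add[OF C(2)] by fastforce
      qed
    qed (rule E)
    moreover have "2 ^ L \<cdot>\<^sub>v e = 0\<^sub>v n" using L e by (simp add: ann_def)
    \<comment> \<open>The induction hypothesis was used with \<open>L\<close> in place of
      \<open>J\<close>, so no label in \<open>es\<close> exceeds \<open>L\<close> and the pivot word
      goes to the end.\<close>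
    moreover have "sorted (map snd (es @ [(e, L)]))" using es(1,2) by (auto simp: sorted_append)
    ultimately show ?thesis
      using es(2,4) card L0 LJ
      by (intro exI[where x = "es @ [(e, L)]"]) (auto simp: power_add)
  qed
qed

section \<open>The columns of \<open>B_mat\<close> as a product of lists\<close>

lemma sorted_concat_replicate:
  "sorted (concat (map (\<lambda>j. replicate (f j) j) [m..<N]))"
  by (induction N) (auto simp: sorted_append)

lemma count_list_replicate: "count_list (replicate m x) y = (if x = y then m else 0)"
  by (induction m) auto

text \<open>Both lists are sorted and have the same multiset of entries.\<close>

lemma concat_replicate_count_list:
  fixes js :: "nat list"
  assumes "sorted js" "set js \<subseteq> {m..<N}"
  shows "concat (map (\<lambda>j. replicate (count_list js j) j) [m..<N]) = js" (is "?r N = js")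
proof -
  have "count (mset (?r N)) x = (if m \<le> x \<and> x < N then count_list js x else 0)" for N x
    by (induction N) (auto simp: count_mset count_list_replicate)
  moreover have "count_list js x = 0" if "\<not> (m \<le> x \<and> x < N)" for x
    using assms(2) that by (auto simp: count_list_0_iff)
  ultimately have "mset (?r N) = mset js"
    by (intro multiset_eqI) (simp add: count_mset)
  thus ?thesis
    using properties_for_sort[OF _ sorted_concat_replicate] sorted_sort_id[OF assms(1)] by metis
qed

lemma length_product_lists: "length (product_lists xss) = prod_list (map length xss)"
  by (induction xss) (auto simp: length_concat comp_def sum_list_triv)

text \<open>When \<open>I\<close> counts the entries of a sorted list \<open>js\<close>, the factors
  of the product appear in the order of \<open>js\<close>. A basis sorted by its labels thus matches
  the rows of \<open>B_mat\<close> below the first one by one.\<close>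

lemma B_columns_count_list:
  assumes "sorted js" "set js \<subseteq> {1..LENGTH('k::len)}"
  shows "B_columns (count_list js) = product_lists ([1::'k word] #
    map (\<lambda>j. sorted_list_of_set (range (\<lambda>a. 2 ^ (LENGTH('k) - j) * a))) js)"
proof -
  define G :: "nat \<Rightarrow> 'k word list" where
    "G j = sorted_list_of_set (range (\<lambda>a. 2 ^ (LENGTH('k) - j) * a))" for j
  have "concat (map (\<lambda>j. replicate (count_list js j) (G j)) [1..<Suc LENGTH('k)])
      = map G (concat (map (\<lambda>j. replicate (count_list js j) j) [1..<Suc LENGTH('k)]))"
    by (simp only: map_concat map_map comp_def map_replicate)
  also have "\<dots> = map G js"
    using assms by (subst concat_replicate_count_list) auto
  finally show ?thesis unfolding B_columns_def G_def [abs_def] by (simp only:)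
qed

section \<open>Codes that contain the all-one word\<close>

text \<open>The all-one word and a basis of \<open>E\<close> generate \<open>D\<close>. The
  \<open>n\<close> columns of their matrix are distinct by \<open>sep\<close> and lie among the
  \<open>n\<close> columns of \<open>B_mat I\<close>, so the two matrices differ by a permutation of
  columns, which also relates the codes their rows generate.\<close>

lemma D_code_of_normalized:
  fixes D :: "'k::len word vec set"
  assumes D: "linear_code n D" and n: "n > 0" and cD: "card D = n * 2 ^ LENGTH('k)"
    and one: "vec n (\<lambda>_. 1) \<in> D"
    and sep: "\<And>i j. i < n \<Longrightarrow> j < n \<Longrightarrow> i \<noteq> j \<Longrightarrow> \<exists>c\<in>D. c $ i \<noteq> c $ j"
  shows "\<exists>I \<pi>. n = 2 ^ (\<Sum>j=1..LENGTH('k). j * I j) \<and> \<pi> permutes {..<n} \<and>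
    D_code I = (\<lambda>x. vec n (\<lambda>i. x $ \<pi> i)) ` D"
proof -
  let ?k = "LENGTH('k)" and ?one = "vec n (\<lambda>_. 1 :: 'k word)"
  \<comment> \<open>The multiples of the all-one word attain every value at coordinate
    \<open>0\<close>, so the kernel \<open>E\<close> complements them and has \<open>n\<close>
    elements.\<close>
  define E where "E = {c \<in> D. c $ 0 = 0}"
  have E: "linear_code n E" unfolding E_def by (rule linear_code_coordinate_kernel[OF D n])
  have "(\<lambda>c. 1 * c $ 0) ` D = UNIV"
  proof (intro equalityI subsetI UNIV_I)
    fix a :: "'k word"
    have "a = 1 * (a \<cdot>\<^sub>v ?one) $ 0" using n by simp
    thus "a \<in> (\<lambda>c. 1 * c $ 0) ` D" using linear_code_smult[OF D one] by blast
  qed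
  hence cE: "card E = n"
    using card_linear_code_coordinate[OF D n, of 1] cD card_word_multiples[where 'k='k, of ?k]
    by (simp add: E_def)
  have "\<exists>es. sorted (map snd es) \<and>
    (\<forall>(e, j)\<in>set es. 1 \<le> j \<and> j \<le> ?k \<and> 2 ^ j \<cdot>\<^sub>v e = 0\<^sub>v n) \<and>
    linear_code n hull (fst ` set es) = E \<and> card E = 2 ^ sum_list (map snd es)"
    by (rule linear_code_basis[OF E order.refl]) (auto intro!: eq_vecI simp: linear_code_dim[OF E])
  then obtain es where es: "sorted (map snd es)"
    and es_ann: "\<forall>(e, j)\<in>set es. 1 \<le> j \<and> j \<le> ?k \<and> 2 ^ j \<cdot>\<^sub>v e = 0\<^sub>v n"
    and es_hull: "linear_code n hull (fst ` set es) = E"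
    and card_es: "card E = 2 ^ sum_list (map snd es)"
    by blast
  have es_E: "e \<in> E" if "(e, j) \<in> set es" for e j
    using that hull_inc[of e "fst ` set es" "linear_code n"] es_hull by force
  define gens where "gens = insert ?one (fst ` set es)"
  have gens: "linear_code n hull gens = D"
  proof (rule hull_unique)
    show "gens \<subseteq> D" using es_E one by (auto simp: gens_def E_def)
    fix C assume C: "gens \<subseteq> C" "linear_code n C"
    hence EC: "E \<subseteq> C" using es_hull hull_minimal[of "fst ` set es" C] by (auto simp: gens_def)
    show "D \<subseteq> C"
    proof
      fix x assume x: "x \<in> D"
      have "x - x $ 0 \<cdot>\<^sub>v ?one \<in> E"
        using linear_code_minus[OF D x linear_code_smult[OF D one]] n
        by (simp add: E_def linear_code_dim[OF D x])
      moreover have "x = (x - x $ 0 \<cdot>\<^sub>v ?one) + x $ 0 \<cdot>\<^sub>v ?one"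
        by (intro eq_vecI) (auto simp: linear_code_dim[OF D x])
      moreover have "x $ 0 \<cdot>\<^sub>v ?one \<in> C"
        using C(1) by (intro linear_code_smult[OF C(2)]) (auto simp: gens_def)
      ultimately show "x \<in> C" using EC linear_code_add[OF C(2)] by fastforce
    qed
  qed (rule D)
  define js where "js = map snd es"
  \<comment> \<open>\<open>I j\<close> is the number of basis words labelled \<open>j\<close>;
    \<open>card E = n\<close> then becomes the condition on \<open>I\<close>.\<close>
  define I where "I = count_list js"
  have js: "set js \<subseteq> {1..?k}" "sorted js" using es es_ann by (auto simp: js_def)
  have nI: "n = 2 ^ (\<Sum>j=1..?k. j * I j)"
    using sum_list_map_eq_sum_count2[OF js(1), of "\<lambda>j. j"] card_es cE
    by (simp add: I_def js_def mult.commute)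
  define G :: "nat \<Rightarrow> 'k word list" where
    "G j = sorted_list_of_set (range (\<lambda>a. 2 ^ (?k - j) * a))" for j
  define cols where "cols = (B_columns I :: 'k word list list)"
  have cols: "cols = product_lists ([1] # map G js)"
    unfolding cols_def I_def G_def by (rule B_columns_count_list[OF js(2,1)])
  have G: "set (G j) = range (\<lambda>a. 2 ^ (?k - j) * a)" "distinct (G j)" for j
    by (simp_all add: G_def)
  have "length (G j) = 2 ^ j" if "j \<in> set js" for j
    using js(1) that card_word_multiples[where 'k='k, of j] by (auto simp: G_def)
  hence "prod_list (map length (map G js)) = prod_list (map (\<lambda>j. 2 ^ j) js)"
    by (auto intro: arg_cong[where f = prod_list])
  also have "\<dots> = 2 ^ sum_list js" by (induction js) (auto simp: power_add)
  finally have len: "length cols = n"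
    using card_es cE by (simp add: cols length_product_lists js_def del: product_lists.simps)
  have dist: "distinct cols"
    unfolding cols using G(2) by (intro distinct_product_lists) auto
  define col where "col i = 1 # map (\<lambda>p. fst p $ i) es" for i
  have col_in: "col i \<in> set cols" if "i < n" for i
  proof -
    have "e $ i \<in> set (G j)" if "(e, j) \<in> set es" for e j
    proof -
      have "(2 ^ j \<cdot>\<^sub>v e) $ i = 0" "j \<le> ?k" using es_ann that \<open>i < n\<close> by auto
      hence "2 ^ j * e $ i = 0" using \<open>i < n\<close> by (simp add: linear_code_dim[OF E es_E[OF that]])
      thus ?thesis using word_annihilator_two_power[OF \<open>j \<le> ?k\<close>] unfolding G by blast
    qed
    thus ?thesis
      unfolding cols product_lists_set col_def js_def
      by (auto simp: list_all2_map1 list_all2_map2 list_all2_same)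
  qed
  have col_inj: "inj_on col {..<n}"
  proof (rule inj_onI, rule ccontr)
    fix i j assume ij: "i \<in> {..<n}" "j \<in> {..<n}" "col i = col j" "i \<noteq> j"
    \<comment> \<open>Words that agree at \<open>i\<close> and \<open>j\<close> form a linear code.
      If it contains the generators it contains \<open>D\<close>, against
      \<open>sep\<close>.\<close>
    have "linear_code n {c \<in> carrier_vec n. c $ i = c $ j}"
      using ij(1,2) by (auto simp: linear_code_def)
    moreover have "gens \<subseteq> {c \<in> carrier_vec n. c $ i = c $ j}"
      using ij es_E linear_code_carrier[OF E] by (auto simp: gens_def col_def)
    ultimately have "D \<subseteq> {c \<in> carrier_vec n. c $ i = c $ j}"
      using gens hull_minimal by metis
    thus False using sep[of i j] ij by auto
  qed
  have "col ` {..<n} = set cols"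
    using col_in card_image[OF col_inj] distinct_card[OF dist] len
    by (intro card_subset_eq) auto
  hence bij_col: "bij_betw col {..<n} (set cols)" using col_inj by (simp add: bij_betw_def)
  have bij_nth: "bij_betw (\<lambda>i. cols ! i) {..<n} (set cols)"
    using bij_betw_nth[OF dist, of "{..<n}" "set cols"] len by simp
  \<comment> \<open>Column \<open>i\<close> of \<open>B_mat I\<close> is column
    \<open>\<pi> i\<close> of the generator matrix. Outside \<open>{..<n}\<close> the map is the
    identity, as \<open>permutes\<close> demands.\<close>
  define \<pi> where "\<pi> i = (if i < n then inv_into {..<n} col (cols ! i) else i)" for i
  have "bij_betw (inv_into {..<n} col \<circ> (\<lambda>i. cols ! i)) {..<n} {..<n}"
    by (rule bij_betw_trans[OF bij_nth bij_betw_inv_into[OF bij_col]])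
  hence "bij_betw \<pi> {..<n} {..<n}" 
    by (subst bij_betw_cong[where g = "inv_into {..<n} col \<circ> (\<lambda>i. cols ! i)"]) (auto simp: \<pi>_def)
  hence \<pi>: "\<pi> permutes {..<n}" by (rule bij_imp_permutes) (simp add: \<pi>_def)
  have col_\<pi>: "cols ! i = col (\<pi> i)" if "i < n" for i
    using that bij_col bij_betw_apply[OF bij_nth] by (simp add: \<pi>_def f_inv_into_f bij_betw_def)
  have \<pi>_less: "\<pi> i < n" if "i < n" for i using permutes_in_image[OF \<pi>] that by auto
  let ?\<psi> = "\<lambda>x::'k word vec. vec n (\<lambda>i. x $ \<pi> i)"
  have "(\<Sum>j=1..?k. I j) = length es"
    using sum_count_set[OF js(1)] by (simp add: I_def js_def)
  hence B: "(B_mat I :: 'k word mat) = mat (Suc (length es)) n (\<lambda>(r, i). cols ! i ! r)"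
    by (simp add: B_mat_def mat_of_cols_list_def len flip: cols_def)
  have row0: "row (B_mat I) 0 = ?\<psi> ?one"
    unfolding B by (intro eq_vecI) (auto simp: col_\<pi> col_def \<pi>_less)
  have rowS: "row (B_mat I) (Suc l) = ?\<psi> (fst (es ! l))" if "l < length es" for l
    unfolding B using that by (intro eq_vecI) (auto simp: col_\<pi> col_def \<pi>_less)
  have "set (rows (B_mat I :: 'k word mat)) = row (B_mat I) ` {..<Suc (length es)}"
    by (simp add: rows_def B atLeast0LessThan del: upt_Suc)
  also have "\<dots> = insert (row (B_mat I) 0) ((\<lambda>l. row (B_mat I) (Suc l)) ` {..<length es})"
    by (simp only: lessThan_Suc_eq_insert_0 image_insert image_image)
  also have "\<dots> = insert (?\<psi> ?one) ((\<lambda>l. ?\<psi> (fst (es ! l))) ` {..<length es})"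
    using row0 rowS by simp
  also have "\<dots> = ?\<psi> ` gens"
    unfolding gens_def image_insert image_image set_conv_nth by auto
  finally have rows: "set (rows (B_mat I)) = ?\<psi> ` gens" .
  have "D_code I = linear_code n hull (?\<psi> ` gens)"
    by (simp add: D_code_def rows) (simp add: B)
  also have "\<dots> = ?\<psi> ` D"
    unfolding gens [symmetric]
  proof (rule hull_linear_code_image)
    show "gens \<subseteq> carrier_vec n"
      using es_E linear_code_carrier[OF E] by (auto simp: gens_def)
  qed (auto intro!: eq_vecI simp: \<pi>_less)
  finally show ?thesis using nI \<pi> by blast
qed

section \<open>Rescaling to the all-one word\<close>

theorem theorem5:
  fixes D :: "'k::len word vec set" and n :: nat
  assumes "\<exists>t. n = 2 ^ t"
    and "linear_code n D"
    and "star_code n (n * 2 ^ LENGTH('k)) (real n * 2 powi (int LENGTH('k) - 2)) D"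
  shows "\<exists>I :: nat \<Rightarrow> nat.
    real (\<Sum>j=1..LENGTH('k). j * I j) = log 2 (real n) \<and> code_equiv n D (D_code I)"
proof -
  note D = assms(2) and star = assms(3)
  have n: "n > 0" using assms(1) by auto
  obtain d where d: "d \<in> D" "\<And>i. i < n \<Longrightarrow> odd (d $ i)"
    using star_code_all_odd[OF D n star] by blast
  have "\<forall>i. \<exists>w. i < n \<longrightarrow> w * d $ i = 1" using word_odd_inverse d(2) by blast
  then obtain w where w: "\<And>i. i < n \<Longrightarrow> w i * d $ i = 1" by metis
  have w_cancel: "d $ i * (w i * x) = x" if "i < n" for i x
    using w[OF that] by (metis mult.assoc mult.commute mult_1)
  have w_odd: "odd (w i)" if "i < n" for i
    using w[OF that] by (metis even_mult_iff odd_one)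
  \<comment> \<open>The units \<open>w i\<close> invert the entries of the all-odd word
    \<open>d\<close>, so \<open>\<phi>\<close> sends \<open>d\<close> to the all-one word.\<close>
  define \<phi> where "\<phi> x = vec n (\<lambda>i. w i * x $ i)" for x
  have \<phi>D: "linear_code n (\<phi> ` D)"
    by (rule linear_code_image[OF _ _ _ D]) (auto intro!: eq_vecI simp: \<phi>_def algebra_simps)
  have "inj_on \<phi> D"
  proof (rule inj_onI)
    fix x y assume xy: "x \<in> D" "y \<in> D" "\<phi> x = \<phi> y"
    have "x $ i = y $ i" if "i < n" for i
      using arg_cong[OF xy(3), of "\<lambda>v. d $ i * v $ i"] that by (simp add: \<phi>_def w_cancel)
    thus "x = y" by (intro eq_vecI) (auto simp: linear_code_dim[OF D] xy)
  qed
  hence card: "card (\<phi> ` D) = n * 2 ^ LENGTH('k)"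
    using star by (simp add: card_image star_code_def)
  have "\<phi> d = vec n (\<lambda>_. 1)" by (auto simp: \<phi>_def w)
  hence one: "vec n (\<lambda>_. 1) \<in> \<phi> ` D" using d(1) by (metis imageI)
  \<comment> \<open>Being zero at one of two coordinates and nonzero at the other survives
    multiplication by units, whereas mere inequality of two entries need not.\<close>
  have sep: "\<exists>c\<in>\<phi> ` D. c $ i \<noteq> c $ j" if ij: "i < n" "j < n" "i \<noteq> j" for i j
  proof -
    obtain c where c: "c \<in> D" "c $ i = 0 \<longleftrightarrow> c $ j \<noteq> 0"
      using star_code_separates[OF D star ij] by blast
    have "w l * c $ l = 0 \<longleftrightarrow> c $ l = 0" if "l < n" for l
      using w_cancel[OF that, of "c $ l"] by (metis mult_zero_right)
    hence "\<phi> c $ i \<noteq> \<phi> c $ j" using ij c(2) by (auto simp: \<phi>_def)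
    thus ?thesis using c(1) by blast
  qed
  obtain I \<pi> where I: "n = 2 ^ (\<Sum>j=1..LENGTH('k). j * I j)" and \<pi>: "\<pi> permutes {..<n}"
    and DI: "D_code I = (\<lambda>x. vec n (\<lambda>i. x $ \<pi> i)) ` \<phi> ` D"
    using D_code_of_normalized[OF \<phi>D n card one sep] by blast
  have \<pi>_less: "\<pi> i < n" if "i < n" for i using permutes_in_image[OF \<pi>] that by auto
  \<comment> \<open>In \<open>code_equiv\<close> the scaling follows the permutation, so the units
    are indexed through \<open>\<pi>\<close>.\<close>
  define z where "z = vec n (\<lambda>i. w (\<pi> i))"
  have "D_code I = (\<lambda>x. vec n (\<lambda>i. z $ i * x $ \<pi> i)) ` D"
    unfolding DI image_image
    by (intro image_cong refl eq_vecI) (auto simp: z_def \<phi>_def \<pi>_less)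
  moreover have "z \<in> carrier_vec n" "\<forall>i<n. odd (z $ i)"
    using w_odd \<pi>_less by (auto simp: z_def)
  ultimately have "code_equiv n D (D_code I)" using \<pi> unfolding code_equiv_def by blast
  moreover have "real (\<Sum>j=1..LENGTH('k). j * I j) = log 2 (real n)"
    by (subst I) (simp add: log_nat_power)
  ultimately show ?thesis by blast
qed

end
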